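(* Let $G$ be a connected graph of order at least $2$ and let $H$ be a rigid graph. Then $fix_f(G\odot H)=fix_f(G)$.
   Context: All graphs are finite, simple, undirected and non-trivial (at least two vertices). A graph is rigid if its automorphism group is trivial. The corona product $G\odot H$ is the graph obtained from one copy of $G$ and $|V(G)|$ disjoint copies of $H$, one copy $H_u$ for each vertex $u\in V(G)$, by joining each vertex of $H_u$ by an edge to $u$. Let $\Gamma=\Gamma(G)$ be the automorphism group of a graph $G$. For $u\in V(G)$, $O(u)$ is the $\Gamma$-orbit of $u$; for $x\in V(G)$, $\Gamma_x$ is the stabilizer of $x$ and $O_x(u)=\{\pi(u):\pi\in\Gamma_x\}$. Let $V_a(G)=\{(u,v): u\neq v,\ O(u)=O(v)\}$. For vertices $u,v$ let $F(u,v)=\{x\in V(G):O_x(u)\neq O_x(v)\}$. A function $g:V(G)\to[0,1]$ is a fixing function of $G$ if $\sum_{x\in F(u,v)}g(x)\ge 1$ for every $(u,v)\in V_a(G)$. Put $|g|=\sum_{x\in V(G)}g(x)$. The fractional fixing number $fix_f(G)$ is the minimum of $|g|$ over all fixing functions $g$ of $G$ (so it is $0$ if $G$ is rigid). *)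

theory Defs
  imports
    "HOL-Analysis.Analysis"
    "HOL-Combinatorics.Permutations"
    "Graph_Theory.Graph_Theory"
begin

text \<open>
  A finite simple undirected graph is a \<^locale>\<open>pair_graph\<close>: a finite set of vertices with a
  symmetric, irreflexive set of arcs, each edge being represented by its two arcs.
\<close>

definition nontrivial_graph :: "'a pair_pre_digraph \<Rightarrow> bool" where
  "nontrivial_graph G \<longleftrightarrow> pair_graph G \<and> card (pverts G) \<ge> 2"

text \<open>
  An automorphism is a permutation of the vertex set, extended by the identity to the whole type
  (this is what \<open>permutes\<close> says), so that distinct members of \<open>aut G\<close> differ on a vertex.
\<close>

definition aut :: "'a pair_pre_digraph \<Rightarrow> ('a \<Rightarrow> 'a) set" where
  "aut G = {\<pi>. \<pi> permutes pverts G \<and>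
     (\<forall>u\<in>pverts G. \<forall>v\<in>pverts G. (\<pi> u, \<pi> v) \<in> parcs G \<longleftrightarrow> (u, v) \<in> parcs G)}"

definition rigid :: "'a pair_pre_digraph \<Rightarrow> bool" where
  "rigid G \<longleftrightarrow> aut G = {id}"

definition aut_stabilizer :: "'a pair_pre_digraph \<Rightarrow> 'a \<Rightarrow> ('a \<Rightarrow> 'a) set" where
  "aut_stabilizer G x = {\<pi> \<in> aut G. \<pi> x = x}"

definition aut_orbit :: "'a pair_pre_digraph \<Rightarrow> 'a \<Rightarrow> 'a set" where
  "aut_orbit G u = {\<pi> u | \<pi>. \<pi> \<in> aut G}"

definition stabilizer_orbit :: "'a pair_pre_digraph \<Rightarrow> 'a \<Rightarrow> 'a \<Rightarrow> 'a set" where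
  "stabilizer_orbit G x u = {\<pi> u | \<pi>. \<pi> \<in> aut_stabilizer G x}"

definition similar_pairs :: "'a pair_pre_digraph \<Rightarrow> ('a \<times> 'a) set" where
  "similar_pairs G =
     {(u, v). u \<in> pverts G \<and> v \<in> pverts G \<and> u \<noteq> v \<and> aut_orbit G u = aut_orbit G v}"

definition fixing_nbhd :: "'a pair_pre_digraph \<Rightarrow> 'a \<Rightarrow> 'a \<Rightarrow> 'a set" where
  "fixing_nbhd G u v = {x \<in> pverts G. stabilizer_orbit G x u \<noteq> stabilizer_orbit G x v}"

text \<open>The values of \<open>g\<close> outside the vertex set play no role.\<close>

definition fixing_function :: "'a pair_pre_digraph \<Rightarrow> ('a \<Rightarrow> real) \<Rightarrow> bool" where
  "fixing_function G g \<longleftrightarrow>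
     (\<forall>x\<in>pverts G. 0 \<le> g x \<and> g x \<le> 1) \<and>
     (\<forall>(u, v)\<in>similar_pairs G. (\<Sum>x\<in>fixing_nbhd G u v. g x) \<ge> 1)"

text \<open>The minimum exists for every finite graph, see \<open>fix_f_attained\<close> below.\<close>

definition fix_f :: "'a pair_pre_digraph \<Rightarrow> real" where
  "fix_f G = (LEAST r. \<exists>g. fixing_function G g \<and> r = (\<Sum>x\<in>pverts G. g x))"

text \<open>\<open>Inl u\<close> is the vertex \<open>u\<close> of \<open>G\<close>, and \<open>Inr (u, h)\<close> is the vertex \<open>h\<close> of the copy of \<open>H\<close> at \<open>u\<close>.\<close>

definition corona ::
  "'a pair_pre_digraph \<Rightarrow> 'b pair_pre_digraph \<Rightarrow> ('a + 'a \<times> 'b) pair_pre_digraph"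
  (infixl "\<odot>" 70) where
  "G \<odot> H =
     \<lparr> pverts = pverts G <+> (pverts G \<times> pverts H),
       parcs =
         {(Inl u, Inl v) | u v. (u, v) \<in> parcs G} \<union>
         {(Inr (u, h), Inr (u, k)) | u h k. u \<in> pverts G \<and> (h, k) \<in> parcs H} \<union>
         {(Inl u, Inr (u, h)) | u h. u \<in> pverts G \<and> h \<in> pverts H} \<union>
         {(Inr (u, h), Inl u) | u h. u \<in> pverts G \<and> h \<in> pverts H} \<rparr>"

lemma pair_graph_corona:
  assumes "pair_graph G" "pair_graph H"
  shows "pair_graph (G \<odot> H)"
proof -
  interpret G: pair_graph G by fact
  interpret H: pair_graph H by fact
  have fin: "finite (pverts (G \<odot> H))"
    by (simp add: corona_def G.pair_finite_verts H.pair_finite_verts)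
  have sub: "parcs (G \<odot> H) \<subseteq> pverts (G \<odot> H) \<times> pverts (G \<odot> H)"
    by (auto simp: corona_def dest: G.in_arcsD1 G.in_arcsD2 H.in_arcsD1 H.in_arcsD2)
  have symG: "sym (parcs G)" and symH: "sym (parcs H)"
    using G.pair_sym_arcs H.pair_sym_arcs by (simp_all add: symmetric_def)
  have "symmetric (G \<odot> H)"
    unfolding symmetric_def using symG symH
    by (auto simp: corona_def sym_def)
  moreover have "fst e \<noteq> snd e" if "e \<in> parcs (G \<odot> H)" for e
    using that G.pair_no_loops H.pair_no_loops by (fastforce simp: corona_def)
  moreover have "finite (parcs (G \<odot> H))"
    using sub fin by (meson finite_SigmaI finite_subset)
  ultimately show ?thesis
    using fin sub by unfold_locales auto
qed

lemma self_in_fixing_nbhd: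
  assumes "(u, v) \<in> similar_pairs G"
  shows "u \<in> fixing_nbhd G u v"
proof -
  have "v \<in> stabilizer_orbit G u v"
    by (auto simp: stabilizer_orbit_def aut_stabilizer_def aut_def intro!: exI[of _ id] permutes_id)
  moreover have "stabilizer_orbit G u u \<subseteq> {u}"
    by (auto simp: stabilizer_orbit_def aut_stabilizer_def)
  ultimately show ?thesis
    using assms by (auto simp: fixing_nbhd_def similar_pairs_def)
qed

lemma fixing_function_const_1:
  assumes "finite (pverts G)"
  shows "fixing_function G (\<lambda>_. 1)"
proof -
  have "1 \<le> real (card (fixing_nbhd G u v))" if "(u, v) \<in> similar_pairs G" for u v
  proof -
    have "finite (fixing_nbhd G u v)" using assms by (simp add: fixing_nbhd_def)
    then have "card (fixing_nbhd G u v) > 0"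
      using self_in_fixing_nbhd[OF that] card_gt_0_iff by blast
    then show ?thesis by linarith
  qed
  then show ?thesis by (auto simp: fixing_function_def)
qed

lemma fix_f_attained:
  assumes fin: "finite (pverts G)"
  shows "\<exists>g. fixing_function G g \<and> fix_f G = (\<Sum>x\<in>pverts G. g x)"
    and "fixing_function G g \<Longrightarrow> fix_f G \<le> (\<Sum>x\<in>pverts G. g x)"
proof -
  let ?V = "pverts G"
  define B where "B = (\<Pi>\<^sub>E i\<in>UNIV. if i \<in> ?V then {0..1} else {0::real})"
  define K where "K = B \<inter> (\<Inter>(u, v)\<in>similar_pairs G. {g. (\<Sum>x\<in>fixing_nbhd G u v. g x) \<ge> 1})"
  have "compact B"
    unfolding B_def
    using compactin_PiE[of "\<lambda>_. euclidean" UNIV "\<lambda>i. if i \<in> ?V then {0..1} else {0::real}"]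
    by (simp add: euclidean_product_topology)
  moreover have cont: "continuous_on UNIV (\<lambda>g::'a \<Rightarrow> real. \<Sum>x\<in>A. g x)" for A
    by (intro continuous_intros continuous_on_product_coordinates)
  have "closed (\<Inter>(u, v)\<in>similar_pairs G. {g. (\<Sum>x\<in>fixing_nbhd G u v. g x) \<ge> (1::real)})"
    by (intro closed_INT ballI) (auto intro!: closed_Collect_le cont)
  ultimately have "compact K"
    unfolding K_def by (intro compact_Int_closed)
  have trunc: "(\<lambda>x. if x \<in> ?V then g x else 0) \<in> K" if "fixing_function G g" for g
  proof -
    have "(\<Sum>x\<in>fixing_nbhd G u v. if x \<in> ?V then g x else 0) = (\<Sum>x\<in>fixing_nbhd G u v. g x)"
      for u v by (rule sum.cong) (auto simp: fixing_nbhd_def)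
    with that show ?thesis by (auto simp: K_def B_def fixing_function_def)
  qed
  have "K \<noteq> {}"
    using trunc[OF fixing_function_const_1[OF fin]] by blast
  then obtain g0 where g0: "g0 \<in> K" "\<And>g. g \<in> K \<Longrightarrow> (\<Sum>x\<in>?V. g0 x) \<le> (\<Sum>x\<in>?V. g x)"
    using continuous_attains_inf[OF \<open>compact K\<close>] continuous_on_subset[OF cont] by blast
  have g0_fix: "fixing_function G g0"
    unfolding fixing_function_def
  proof
    have "g0 x \<in> (if x \<in> ?V then {0..1} else {0})" for x
      using g0(1) by (auto simp: K_def B_def PiE_def Pi_def)
    then show "\<forall>x\<in>?V. 0 \<le> g0 x \<and> g0 x \<le> 1" by (metis atLeastAtMost_iff)
  next
    show "\<forall>(u, v)\<in>similar_pairs G. (\<Sum>x\<in>fixing_nbhd G u v. g0 x) \<ge> 1"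
      using g0(1) by (auto simp: K_def)
  qed
  have g0_min: "(\<Sum>x\<in>?V. g0 x) \<le> (\<Sum>x\<in>?V. g x)" if "fixing_function G g" for g
    using g0(2)[OF trunc[OF that]] by simp
  have eq: "fix_f G = (\<Sum>x\<in>?V. g0 x)"
    unfolding fix_f_def using g0_fix g0_min by (intro Least_equality) auto
  show "\<exists>g. fixing_function G g \<and> fix_f G = (\<Sum>x\<in>?V. g x)"
    using eq g0_fix by blast
  show "fixing_function G g \<Longrightarrow> fix_f G \<le> (\<Sum>x\<in>?V. g x)"
    using eq g0_min by simp
qed

end

theory Submission
  imports Defs
begin

text \<open>
  In \<^term>\<open>G \<odot> H\<close> a vertex of \<open>G\<close> has degree at least \<open>1 + |H|\<close>, since \<open>G\<close> is connected and has a
  second vertex, whereas a vertex of a copy of \<open>H\<close> has degree at most \<open>(|H| - 1) + 1\<close>. So every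
  automorphism of the corona maps \<open>G\<close> to itself, and on \<open>G\<close> it is an automorphism \<open>\<sigma>\<close>. Adjacency to
  the base vertex forces it to map the copy at \<open>u\<close> to the copy at \<open>\<sigma> u\<close>, and rigidity of \<open>H\<close> leaves
  only one way of doing so. Hence the automorphisms of the corona are exactly the maps that move
  each copy of \<open>H\<close> along with its base vertex by an automorphism of \<open>G\<close>
  (\<open>aut_corona_project\<close> and \<open>aut_corona_lift\<close>).

  Consequently the corona splits into \<open>1 + |H|\<close> layers, each of them carrying a copy of the action
  of the automorphism group on \<open>G\<close>: two vertices are similar iff they lie in the same layer over
  similar vertices of \<open>G\<close>, and a vertex separates two such vertices iff its base vertex separates
  their base vertices. A fixing function of \<open>G\<close> therefore extends by zero to the corona, and
  conversely a fixing function of the corona can be summed over the vertices with a common base,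
  the sums being cut off at \<open>1\<close>.
\<close>

section \<open>Layers of the corona\<close>

text \<open>
  The layer \<^term>\<open>None\<close> is \<open>G\<close> itself; the layer \<^term>\<open>Some h\<close> consists of the vertices \<open>h\<close> in all
  the copies of \<open>H\<close>. This treats the two kinds of vertices of the corona uniformly.
\<close>

definition layer :: "'b option \<Rightarrow> 'a \<Rightarrow> 'a + 'a \<times> 'b" where
  "layer t u = (case t of None \<Rightarrow> Inl u | Some h \<Rightarrow> Inr (u, h))"

definition layers :: "'b pair_pre_digraph \<Rightarrow> 'b option set" where
  "layers H = insert None (Some ` pverts H)"

lemma layer_simps [simp]: "layer None u = Inl u" "layer (Some h) u = Inr (u, h)"
  by (simp_all add: layer_def)

lemma layer_eq_iff [simp]: "layer s u = layer t v \<longleftrightarrow> s = t \<and> u = v"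
  by (cases s; cases t) auto

lemma finite_layers [simp]: "finite (pverts H) \<Longrightarrow> finite (layers H)"
  by (simp add: layers_def)

lemma None_in_layers [simp]: "None \<in> layers H"
  by (simp add: layers_def)

lemma pverts_corona: "pverts (G \<odot> H) = (\<lambda>(u, t). layer t u) ` (pverts G \<times> layers H)"
proof (intro equalityI subsetI)
  fix y assume y: "y \<in> pverts (G \<odot> H)"
  then show "y \<in> (\<lambda>(u, t). layer t u) ` (pverts G \<times> layers H)"
  proof (cases y)
    case (Inl u)
    then show ?thesis
      using y by (intro image_eqI[where x = "(u, None)"]) (auto simp: corona_def layers_def)
  next
    case (Inr p)
    then show ?thesis
      using y by (intro image_eqI[where x = "(fst p, Some (snd p))"])
        (auto simp: corona_def layers_def)
  qed
qed (auto simp: corona_def layers_def)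

lemma layer_in_corona [simp]: "layer t u \<in> pverts (G \<odot> H) \<longleftrightarrow> u \<in> pverts G \<and> t \<in> layers H"
  by (auto simp: pverts_corona)

lemma Inl_in_corona [simp]: "Inl u \<in> pverts (G \<odot> H) \<longleftrightarrow> u \<in> pverts G"
  by (auto simp: corona_def)

lemma Inr_in_corona [simp]: "Inr (u, h) \<in> pverts (G \<odot> H) \<longleftrightarrow> u \<in> pverts G \<and> h \<in> pverts H"
  by (auto simp: corona_def)

lemma corona_vertexE:
  assumes "y \<in> pverts (G \<odot> H)"
  obtains u t where "u \<in> pverts G" "t \<in> layers H" "y = layer t u"
  using assms by (auto simp: pverts_corona)

lemma sum_over_layers:
  "(\<Sum>y\<in>(\<lambda>(x, t). layer t x) ` (A \<times> L). f y) = (\<Sum>x\<in>A. \<Sum>t\<in>L. f (layer t x))"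
proof -
  have "inj_on (\<lambda>(x, t). layer t x) (A \<times> L)"
    by (auto simp: inj_on_def)
  then show ?thesis
    by (simp add: sum.reindex sum.cartesian_product case_prod_unfold)
qed

lemma corona_arcs [simp]:
  "(Inl u, Inl v) \<in> parcs (G \<odot> H) \<longleftrightarrow> (u, v) \<in> parcs G"
  "(Inl u, Inr (v, k)) \<in> parcs (G \<odot> H) \<longleftrightarrow> u = v \<and> u \<in> pverts G \<and> k \<in> pverts H"
  "(Inr (u, h), Inl v) \<in> parcs (G \<odot> H) \<longleftrightarrow> u = v \<and> u \<in> pverts G \<and> h \<in> pverts H"
  "(Inr (u, h), Inr (v, k)) \<in> parcs (G \<odot> H) \<longleftrightarrow> u = v \<and> u \<in> pverts G \<and> (h, k) \<in> parcs H"
  by (auto simp: corona_def)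

section \<open>Automorphisms of the corona\<close>

lemma aut_permutes: "\<pi> \<in> aut G \<Longrightarrow> \<pi> permutes pverts G"
  by (simp add: aut_def)

lemma aut_arc_iff:
  "\<lbrakk>\<pi> \<in> aut G; u \<in> pverts G; v \<in> pverts G\<rbrakk> \<Longrightarrow> (\<pi> u, \<pi> v) \<in> parcs G \<longleftrightarrow> (u, v) \<in> parcs G"
  by (simp add: aut_def)

lemma aut_in_pverts: "\<lbrakk>\<pi> \<in> aut G; u \<in> pverts G\<rbrakk> \<Longrightarrow> \<pi> u \<in> pverts G"
  by (rule iffD2[OF permutes_in_image[OF aut_permutes]])

lemma aut_eq_iff: "\<pi> \<in> aut G \<Longrightarrow> \<pi> u = \<pi> v \<longleftrightarrow> u = v"
  by (rule inj_eq[OF permutes_inj[OF aut_permutes]])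

lemma id_in_aut: "id \<in> aut G"
  by (simp add: aut_def permutes_id)

lemma aut_of_injection:
  assumes fin: "finite (pverts G)" and inj: "inj_on f (pverts G)"
    and into: "\<And>u. u \<in> pverts G \<Longrightarrow> f u \<in> pverts G"
    and arcs: "\<And>u v. \<lbrakk>u \<in> pverts G; v \<in> pverts G\<rbrakk> \<Longrightarrow> (f u, f v) \<in> parcs G \<longleftrightarrow> (u, v) \<in> parcs G"
  shows "(\<lambda>u. if u \<in> pverts G then f u else u) \<in> aut G"
proof -
  have "(\<lambda>u. if u \<in> pverts G then f u else u) permutes pverts G"
  proof (rule inj_imp_permutes[OF _ fin])
    show "inj_on (\<lambda>u. if u \<in> pverts G then f u else u) (pverts G)"
      by (rule inj_onI) (simp add: inj_on_eq_iff[OF inj])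
  qed (simp_all add: into)
  then show ?thesis by (simp add: aut_def arcs)
qed

lemma card_neighbours_aut:
  assumes wf: "pair_wf_digraph G" and \<pi>: "\<pi> \<in> aut G" and x: "x \<in> pverts G"
  shows "card {y. (\<pi> x, y) \<in> parcs G} = card {y. (x, y) \<in> parcs G}"
proof -
  interpret pair_wf_digraph G by fact
  have "{y. (\<pi> x, y) \<in> parcs G} = \<pi> ` {y. (x, y) \<in> parcs G}"
  proof (intro set_eqI iffI)
    fix y assume "y \<in> {y. (\<pi> x, y) \<in> parcs G}"
    then have y: "(\<pi> x, y) \<in> parcs G" by simp
    have "y \<in> \<pi> ` pverts G"
      using in_arcsD2[OF y] permutes_image[OF aut_permutes[OF \<pi>]] by simp
    then obtain z where z: "z \<in> pverts G" "y = \<pi> z" by blast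
    then have "(x, z) \<in> parcs G"
      using y aut_arc_iff[OF \<pi> x z(1)] by simp
    then show "y \<in> \<pi> ` {y. (x, y) \<in> parcs G}"
      using z(2) by simp
  next
    fix y assume "y \<in> \<pi> ` {y. (x, y) \<in> parcs G}"
    then obtain z where z: "(x, z) \<in> parcs G" "y = \<pi> z" by blast
    then show "y \<in> {y. (\<pi> x, y) \<in> parcs G}"
      using aut_arc_iff[OF \<pi> x in_arcsD2[OF z(1)]] by simp
  qed
  then show ?thesis
    using permutes_inj_on[OF aut_permutes[OF \<pi>]] by (simp add: card_image)
qed

lemma connected_has_neighbour:
  assumes G: "nontrivial_graph G" and con: "Digraph_Component.connected (with_proj G)"
    and u: "u \<in> pverts G"
  shows "\<exists>v. (u, v) \<in> parcs G"
proof -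
  interpret pair_graph G using G by (simp add: nontrivial_graph_def)
  have "pverts G \<noteq> {u}" using G by (auto simp: nontrivial_graph_def)
  then obtain w where w: "w \<in> pverts G" "w \<noteq> u" using u by blast
  have "strongly_connected (with_proj G)"
    using symmetric_connected_imp_strongly_connected[OF pair_sym_arcs con] .
  then have "reachable (with_proj G) u w" using u w by (auto simp: strongly_connected_def)
  then show ?thesis
    using w(2) by (cases rule: converse_reachable_cases) auto
qed

text \<open>
  The two bounds on degrees separate the vertices of \<open>G\<close> from those of the copies of \<open>H\<close>. The
  strict inequality needs a neighbour in \<open>G\<close>: over an isolated vertex \<open>u\<close>, a vertex of \<open>H\<close> adjacent
  to all the others has the same degree in the corona as \<open>u\<close>.
\<close>

lemma card_neighbours_base:
  assumes G: "pair_graph G" and H: "pair_graph H" and u: "u \<in> pverts G"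
    and nb: "\<exists>v. (u, v) \<in> parcs G"
  shows "card {y. (Inl u, y) \<in> parcs (G \<odot> H)} > card (pverts H)"
proof -
  interpret G: pair_graph G by fact
  interpret H: pair_graph H by fact
  interpret C: pair_graph "G \<odot> H" using pair_graph_corona[OF G H] .
  obtain v where v: "(u, v) \<in> parcs G" using nb by blast
  have "Suc (card (pverts H)) = card (insert (Inl v) (Inr ` Pair u ` pverts H))"
    using H.pair_finite_verts by (subst card_insert_disjoint) (auto simp: card_image inj_on_def)
  also have "\<dots> \<le> card {y. (Inl u, y) \<in> parcs (G \<odot> H)}"
  proof (rule card_mono)
    show "finite {y. (Inl u, y) \<in> parcs (G \<odot> H)}"
      by (rule finite_subset[OF _ C.pair_finite_verts]) (use C.in_arcsD2 in blast)
    show "insert (Inl v) (Inr ` Pair u ` pverts H) \<subseteq> {y. (Inl u, y) \<in> parcs (G \<odot> H)}"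
      using u v by auto
  qed
  finally show ?thesis by simp
qed

lemma card_neighbours_copy:
  fixes G :: "'a pair_pre_digraph" and H :: "'b pair_pre_digraph"
  assumes H: "pair_graph H" and h: "h \<in> pverts H"
  shows "card {y. (Inr (u, h), y) \<in> parcs (G \<odot> H)} \<le> card (pverts H)"
proof -
  interpret H: pair_graph H by fact
  have "{y. (Inr (u, h), y) \<in> parcs (G \<odot> H)} \<subseteq> insert (Inl u) (Inr ` Pair u ` (pverts H - {h}))"
  proof
    fix y assume y: "y \<in> {y. (Inr (u, h), y) \<in> parcs (G \<odot> H)}"
    have copy: "k \<in> pverts H - {h}" if "(h, k) \<in> parcs H" for k
      using H.in_arcsD2[OF that] H.pair_no_loops[OF that] by auto
    show "y \<in> insert (Inl u) (Inr ` Pair u ` (pverts H - {h}))"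
    proof (cases y)
      case (Inl v)
      then show ?thesis using y by simp
    next
      case (Inr p)
      with y obtain k where "p = (u, k)" "(h, k) \<in> parcs H"
        by (cases p) simp
      then show ?thesis using Inr copy[of k] by blast
    qed
  qed
  then have "card {y. (Inr (u, h), y) \<in> parcs (G \<odot> H)}
      \<le> card (insert (Inl u) (Inr ` Pair u ` (pverts H - {h})) :: ('a + 'a \<times> 'b) set)"
    using H.pair_finite_verts by (intro card_mono) auto
  also have "\<dots> = Suc (card (pverts H - {h}))"
    using H.pair_finite_verts by (subst card_insert_disjoint) (auto simp: card_image inj_on_def)
  also have "\<dots> = card (pverts H)"
    using H.pair_finite_verts h by (rule card_Suc_Diff1)
  finally show ?thesis .
qed

text \<open>Each vertex of a copy of \<open>H\<close> travels with its base vertex and keeps its position in the copy.\<close>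

lemma aut_corona_lift:
  assumes G: "pair_graph G" and H: "pair_graph H" and \<sigma>: "\<sigma> \<in> aut G"
  obtains \<pi> where "\<pi> \<in> aut (G \<odot> H)"
    "\<And>u t. \<lbrakk>u \<in> pverts G; t \<in> layers H\<rbrakk> \<Longrightarrow> \<pi> (layer t u) = layer t (\<sigma> u)"
proof -
  interpret C: pair_graph "G \<odot> H" using pair_graph_corona[OF G H] .
  define f where "f = map_sum \<sigma> (map_prod \<sigma> (id :: 'b \<Rightarrow> 'b))"
  have f: "f (layer t u) = layer t (\<sigma> u)" for t u
    by (cases t) (simp_all add: f_def)
  have "(\<lambda>y. if y \<in> pverts (G \<odot> H) then f y else y) \<in> aut (G \<odot> H)"
  proof (rule aut_of_injection)
    show "finite (pverts (G \<odot> H))" by (rule C.pair_finite_verts)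
    show "inj_on f (pverts (G \<odot> H))"
    proof (rule inj_onI)
      fix y z assume y: "y \<in> pverts (G \<odot> H)" and z: "z \<in> pverts (G \<odot> H)" and eq: "f y = f z"
      from y obtain u s where us: "y = layer s u" by (rule corona_vertexE)
      from z obtain v t where vt: "z = layer t v" by (rule corona_vertexE)
      show "y = z" using eq by (simp add: us vt f aut_eq_iff[OF \<sigma>])
    qed
    show "f y \<in> pverts (G \<odot> H)" if "y \<in> pverts (G \<odot> H)" for y
      using that by (rule corona_vertexE) (simp add: f aut_in_pverts[OF \<sigma>])
    have \<sigma>_in: "\<sigma> u \<in> pverts G \<longleftrightarrow> u \<in> pverts G" for u
      using permutes_in_image[OF aut_permutes[OF \<sigma>]] .
    show "(f y, f z) \<in> parcs (G \<odot> H) \<longleftrightarrow> (y, z) \<in> parcs (G \<odot> H)"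
      if "y \<in> pverts (G \<odot> H)" "z \<in> pverts (G \<odot> H)" for y z
      using that \<sigma>_in
      by (cases y; cases z)
        (auto simp: f_def aut_arc_iff[OF \<sigma>] aut_eq_iff[OF \<sigma>])
  qed
  then show ?thesis
    by (rule that) (simp add: f)
qed

text \<open>
  Degrees show that \<open>\<pi>\<close> preserves \<open>G\<close>, which gives \<open>\<sigma>\<close>. A vertex over \<open>u\<close> is adjacent to \<open>u\<close>, so
  its image is adjacent to \<open>\<sigma> u\<close> and thus lies over \<open>\<sigma> u\<close>. Reading off only the positions in the
  copies, \<open>\<pi>\<close> induces an automorphism \<open>\<tau>\<close> of \<open>H\<close> for each \<open>u\<close>, and rigidity makes it the identity.
\<close>

lemma aut_corona_project:
  assumes G: "nontrivial_graph G" and con: "Digraph_Component.connected (with_proj G)"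
    and H: "pair_graph H" and rigid: "rigid H" and \<pi>: "\<pi> \<in> aut (G \<odot> H)"
  obtains \<sigma> where "\<sigma> \<in> aut G"
    "\<And>u t. \<lbrakk>u \<in> pverts G; t \<in> layers H\<rbrakk> \<Longrightarrow> \<pi> (layer t u) = layer t (\<sigma> u)"
proof -
  have G': "pair_graph G" using G by (simp add: nontrivial_graph_def)
  interpret G: pair_graph G by fact
  interpret H: pair_graph H by fact
  interpret C: pair_graph "G \<odot> H" using pair_graph_corona[OF G' H] .
  note deg = card_neighbours_aut[OF C.pair_wf_digraph_axioms \<pi>]
  have base_deg: "card {y. (Inl u, y) \<in> parcs (G \<odot> H)} > card (pverts H)" if "u \<in> pverts G" for u
    using card_neighbours_base[OF G' H that connected_has_neighbour[OF G con that]] .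

  define \<sigma> where "\<sigma> u = projl (\<pi> (Inl u))" for u
  have base: "\<pi> (Inl u) = Inl (\<sigma> u)" "\<sigma> u \<in> pverts G" if u: "u \<in> pverts G" for u
  proof -
    have im: "\<pi> (Inl u) \<in> pverts (G \<odot> H)" using aut_in_pverts[OF \<pi>] u by simp
    have "\<pi> (Inl u) \<noteq> Inr (w, k)" for w k
    proof
      assume eq: "\<pi> (Inl u) = Inr (w, k)"
      have "card {y. (Inr (w, k), y) \<in> parcs (G \<odot> H)} \<le> card (pverts H)"
        using im eq by (intro card_neighbours_copy[OF H]) simp
      then show False using base_deg[OF u] deg[of "Inl u"] u eq by simp
    qed
    then show "\<pi> (Inl u) = Inl (\<sigma> u)" by (cases "\<pi> (Inl u)") (auto simp: \<sigma>_def)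
    with im show "\<sigma> u \<in> pverts G" by simp
  qed
  have \<sigma>_aut: "(\<lambda>u. if u \<in> pverts G then \<sigma> u else u) \<in> aut G"
  proof (rule aut_of_injection[OF G.pair_finite_verts])
    show "inj_on \<sigma> (pverts G)"
    proof (rule inj_onI)
      fix u v assume uv: "u \<in> pverts G" "v \<in> pverts G" "\<sigma> u = \<sigma> v"
      then have "\<pi> (Inl u) = \<pi> (Inl v)" by (simp add: base(1))
      then show "u = v" by (simp add: aut_eq_iff[OF \<pi>])
    qed
    show "(\<sigma> u, \<sigma> v) \<in> parcs G \<longleftrightarrow> (u, v) \<in> parcs G"
      if "u \<in> pverts G" "v \<in> pverts G" for u v
      using aut_arc_iff[OF \<pi>, of "Inl u" "Inl v"] that by (simp add: base)
  qed (rule base)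

  have copy: "\<pi> (Inr (u, h)) = Inr (\<sigma> u, h)" if u: "u \<in> pverts G" and h: "h \<in> pverts H" for u h
  proof -
    define \<tau> where "\<tau> k = snd (projr (\<pi> (Inr (u, k))))" for k
    have \<tau>: "\<pi> (Inr (u, k)) = Inr (\<sigma> u, \<tau> k)" "\<tau> k \<in> pverts H" if k: "k \<in> pverts H" for k
    proof -
      have im: "\<pi> (Inr (u, k)) \<in> pverts (G \<odot> H)" using aut_in_pverts[OF \<pi>] u k by simp
      have "\<pi> (Inr (u, k)) \<noteq> Inl w" for w
      proof
        assume eq: "\<pi> (Inr (u, k)) = Inl w"
        then have "card {y. (Inl w, y) \<in> parcs (G \<odot> H)} > card (pverts H)"
          using im by (intro base_deg) simp
        then show False
          using card_neighbours_copy[OF H k, of u G] deg[of "Inr (u, k)"] u k eq by simp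
      qed
      then obtain w l where wl: "\<pi> (Inr (u, k)) = Inr (w, l)"
        by (cases "\<pi> (Inr (u, k))") auto
      moreover have "w = \<sigma> u"
        using aut_arc_iff[OF \<pi>, of "Inl u" "Inr (u, k)"] wl u k by (simp add: base)
      ultimately show "\<pi> (Inr (u, k)) = Inr (\<sigma> u, \<tau> k)" by (simp add: \<tau>_def)
      with im show "\<tau> k \<in> pverts H" by simp
    qed
    have "(\<lambda>k. if k \<in> pverts H then \<tau> k else k) \<in> aut H"
    proof (rule aut_of_injection[OF H.pair_finite_verts])
      show "inj_on \<tau> (pverts H)"
      proof (rule inj_onI)
        fix k l assume kl: "k \<in> pverts H" "l \<in> pverts H" "\<tau> k = \<tau> l"
        then have "\<pi> (Inr (u, k)) = \<pi> (Inr (u, l))" by (simp add: \<tau>(1))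
        then show "k = l" by (simp add: aut_eq_iff[OF \<pi>])
      qed
      show "(\<tau> k, \<tau> l) \<in> parcs H \<longleftrightarrow> (k, l) \<in> parcs H"
        if "k \<in> pverts H" "l \<in> pverts H" for k l
        using aut_arc_iff[OF \<pi>, of "Inr (u, k)" "Inr (u, l)"] that u by (simp add: \<tau> base)
    qed (rule \<tau>)
    then have "(\<lambda>k. if k \<in> pverts H then \<tau> k else k) = id"
      using rigid by (simp add: rigid_def)
    from fun_cong[OF this, of h] have "\<tau> h = h" using h by simp
    then show ?thesis using \<tau>(1)[OF h] by simp
  qed
  show ?thesis
  proof (rule that[OF \<sigma>_aut])
    show "\<pi> (layer t u) = layer t (if u \<in> pverts G then \<sigma> u else u)"
      if "u \<in> pverts G" "t \<in> layers H" for u t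
      using that by (auto simp: layers_def base copy)
  qed
qed

section \<open>Fixing functions of the corona\<close>

lemma self_in_aut_orbit: "u \<in> aut_orbit G u"
  using id_in_aut[of G] by (auto simp: aut_orbit_def intro!: exI[of _ id])

context
  fixes G :: "'a pair_pre_digraph" and H :: "'b pair_pre_digraph"
  assumes G: "nontrivial_graph G" and con: "Digraph_Component.connected (with_proj G)"
    and H: "pair_graph H" and rig: "rigid H"
begin

lemma G_graph: "pair_graph G"
  using G by (simp add: nontrivial_graph_def)

lemma aut_orbit_corona:
  assumes u: "u \<in> pverts G" and t: "t \<in> layers H"
  shows "aut_orbit (G \<odot> H) (layer t u) = layer t ` aut_orbit G u"
proof (intro equalityI subsetI)
  fix y assume "y \<in> aut_orbit (G \<odot> H) (layer t u)"
  then obtain \<pi> where \<pi>: "\<pi> \<in> aut (G \<odot> H)" "y = \<pi> (layer t u)"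
    by (auto simp: aut_orbit_def)
  obtain \<sigma> where "\<sigma> \<in> aut G" "\<pi> (layer t u) = layer t (\<sigma> u)"
    using aut_corona_project[OF G con H rig \<pi>(1)] u t by metis
  then show "y \<in> layer t ` aut_orbit G u"
    using \<pi> by (auto simp: aut_orbit_def)
next
  fix y assume "y \<in> layer t ` aut_orbit G u"
  then obtain \<sigma> where \<sigma>: "\<sigma> \<in> aut G" "y = layer t (\<sigma> u)"
    by (auto simp: aut_orbit_def)
  obtain \<pi> where "\<pi> \<in> aut (G \<odot> H)" "\<pi> (layer t u) = layer t (\<sigma> u)"
    using aut_corona_lift[OF G_graph H \<sigma>(1)] u t by metis
  then show "y \<in> aut_orbit (G \<odot> H) (layer t u)"
    using \<sigma> by (auto simp: aut_orbit_def intro!: exI[of _ \<pi>])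
qed

text \<open>
  An automorphism of the corona fixes a vertex iff it fixes its base vertex, so the layer \<open>s\<close> of the
  stabilized vertex has no influence on the orbits.
\<close>

lemma stabilizer_orbit_corona:
  assumes x: "x \<in> pverts G" and s: "s \<in> layers H" and u: "u \<in> pverts G" and t: "t \<in> layers H"
  shows "stabilizer_orbit (G \<odot> H) (layer s x) (layer t u) = layer t ` stabilizer_orbit G x u"
proof (intro equalityI subsetI)
  fix y assume "y \<in> stabilizer_orbit (G \<odot> H) (layer s x) (layer t u)"
  then obtain \<pi> where \<pi>: "\<pi> \<in> aut (G \<odot> H)" "\<pi> (layer s x) = layer s x" "y = \<pi> (layer t u)"
    by (auto simp: stabilizer_orbit_def aut_stabilizer_def)
  obtain \<sigma> where \<sigma>: "\<sigma> \<in> aut G" "\<pi> (layer t u) = layer t (\<sigma> u)" "\<pi> (layer s x) = layer s (\<sigma> x)"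
    using aut_corona_project[OF G con H rig \<pi>(1)] x s u t by metis
  then have "\<sigma> u \<in> stabilizer_orbit G x u"
    using \<pi>(2) by (auto simp: stabilizer_orbit_def aut_stabilizer_def)
  then show "y \<in> layer t ` stabilizer_orbit G x u"
    using \<pi>(3) \<sigma>(2) by simp
next
  fix y assume "y \<in> layer t ` stabilizer_orbit G x u"
  then obtain \<sigma> where \<sigma>: "\<sigma> \<in> aut G" "\<sigma> x = x" "y = layer t (\<sigma> u)"
    by (auto simp: stabilizer_orbit_def aut_stabilizer_def)
  obtain \<pi> where "\<pi> \<in> aut (G \<odot> H)" "\<pi> (layer t u) = layer t (\<sigma> u)" "\<pi> (layer s x) = layer s (\<sigma> x)"
    using aut_corona_lift[OF G_graph H \<sigma>(1)] x s u t by metis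
  then show "y \<in> stabilizer_orbit (G \<odot> H) (layer s x) (layer t u)"
    using \<sigma> by (auto simp: stabilizer_orbit_def aut_stabilizer_def intro!: exI[of _ \<pi>])
qed

lemma similar_pairs_corona:
  assumes "u \<in> pverts G" "s \<in> layers H" "v \<in> pverts G" "t \<in> layers H"
  shows "(layer s u, layer t v) \<in> similar_pairs (G \<odot> H) \<longleftrightarrow> s = t \<and> (u, v) \<in> similar_pairs G"
proof -
  have inj: "inj (layer t :: 'a \<Rightarrow> 'a + 'a \<times> 'b)" by (auto intro: injI)
  have "s = t" if "layer s ` aut_orbit G u = layer t ` aut_orbit G v"
    using that self_in_aut_orbit[of u G] by (metis imageE imageI layer_eq_iff)
  with assms show ?thesis
    by (auto simp: similar_pairs_def aut_orbit_corona inj_image_eq_iff[OF inj])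
qed

lemma fixing_nbhd_corona:
  assumes u: "u \<in> pverts G" and v: "v \<in> pverts G" and t: "t \<in> layers H"
  shows "fixing_nbhd (G \<odot> H) (layer t u) (layer t v)
    = (\<lambda>(x, s). layer s x) ` (fixing_nbhd G u v \<times> layers H)"
proof -
  have inj: "inj (layer t :: 'a \<Rightarrow> 'a + 'a \<times> 'b)" by (auto intro: injI)
  have "layer s x \<in> fixing_nbhd (G \<odot> H) (layer t u) (layer t v) \<longleftrightarrow> x \<in> fixing_nbhd G u v"
    if "x \<in> pverts G" "s \<in> layers H" for x s
    using that assms by (simp add: fixing_nbhd_def stabilizer_orbit_corona inj_image_eq_iff[OF inj])
  moreover have "fixing_nbhd (G \<odot> H) (layer t u) (layer t v) \<subseteq> pverts (G \<odot> H)"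
    and "fixing_nbhd G u v \<subseteq> pverts G"
    by (auto simp: fixing_nbhd_def)
  ultimately show ?thesis
    by (fastforce elim!: corona_vertexE)
qed

text \<open>
  Only the total weight above each vertex of \<open>G\<close> enters the fixing condition, and every layer
  imposes the same condition on these weights.
\<close>

lemma fixing_function_corona_iff:
  "fixing_function (G \<odot> H) f \<longleftrightarrow>
    (\<forall>x\<in>pverts G. \<forall>t\<in>layers H. 0 \<le> f (layer t x) \<and> f (layer t x) \<le> 1) \<and>
    (\<forall>(u, v)\<in>similar_pairs G. (\<Sum>x\<in>fixing_nbhd G u v. \<Sum>t\<in>layers H. f (layer t x)) \<ge> 1)"
proof -
  have range: "(\<forall>y\<in>pverts (G \<odot> H). 0 \<le> f y \<and> f y \<le> 1) \<longleftrightarrow>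
      (\<forall>x\<in>pverts G. \<forall>t\<in>layers H. 0 \<le> f (layer t x) \<and> f (layer t x) \<le> 1)"
    by (auto simp: pverts_corona)
  have nbhd: "(\<Sum>y\<in>fixing_nbhd (G \<odot> H) (layer t u) (layer t v). f y)
      = (\<Sum>x\<in>fixing_nbhd G u v. \<Sum>t\<in>layers H. f (layer t x))"
    if "u \<in> pverts G" "v \<in> pverts G" "t \<in> layers H" for u v t
    using that by (simp add: fixing_nbhd_corona sum_over_layers)
  have "(\<forall>(y, z)\<in>similar_pairs (G \<odot> H). (\<Sum>x\<in>fixing_nbhd (G \<odot> H) y z. f x) \<ge> 1) \<longleftrightarrow>
    (\<forall>(u, v)\<in>similar_pairs G. (\<Sum>x\<in>fixing_nbhd G u v. \<Sum>t\<in>layers H. f (layer t x)) \<ge> 1)"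
    (is "?L \<longleftrightarrow> ?R")
  proof
    assume L: ?L
    show ?R
    proof clarify
      fix u v assume uv: "(u, v) \<in> similar_pairs G"
      then have V: "u \<in> pverts G" "v \<in> pverts G" by (auto simp: similar_pairs_def)
      have "(layer None u, layer None v) \<in> similar_pairs (G \<odot> H)"
        using uv V similar_pairs_corona None_in_layers by blast
      then show "(\<Sum>x\<in>fixing_nbhd G u v. \<Sum>t\<in>layers H. f (layer t x)) \<ge> 1"
        using L nbhd[OF V None_in_layers] by force
    qed
  next
    assume R: ?R
    show ?L
    proof clarify
      fix y z assume yz: "(y, z) \<in> similar_pairs (G \<odot> H)"
      then have "y \<in> pverts (G \<odot> H)" "z \<in> pverts (G \<odot> H)" by (auto simp: similar_pairs_def)
      then obtain u s v t where yz_eq: "y = layer s u" "z = layer t v"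
        and mem: "u \<in> pverts G" "s \<in> layers H" "v \<in> pverts G" "t \<in> layers H"
        by (metis corona_vertexE)
      then have "s = t" "(u, v) \<in> similar_pairs G"
        using yz similar_pairs_corona by blast+
      then show "(\<Sum>x\<in>fixing_nbhd (G \<odot> H) y z. f x) \<ge> 1"
        using R nbhd[OF mem(1,3,4)] yz_eq by force
    qed
  qed
  then show ?thesis by (simp add: fixing_function_def range)
qed

text \<open>An optimal fixing function of \<open>G\<close>, put on the layer of \<open>G\<close> alone, has the same weights above each vertex.\<close>

lemma fix_f_corona_le: "fix_f (G \<odot> H) \<le> fix_f G"
proof -
  interpret G: pair_graph G by (rule G_graph)
  interpret H: pair_graph H by (rule H)
  interpret C: pair_graph "G \<odot> H" using pair_graph_corona[OF G_graph H] .
  obtain g where g: "fixing_function G g" "fix_f G = (\<Sum>x\<in>pverts G. g x)"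
    using fix_f_attained(1)[OF G.pair_finite_verts] by blast
  define f :: "'a + 'a \<times> 'b \<Rightarrow> real" where "f = case_sum g (\<lambda>_. 0)"
  have f_layer: "f (layer t x) = (if t = None then g x else 0)" for t x
    by (cases t) (simp_all add: f_def)
  then have sum_f: "(\<Sum>t\<in>layers H. f (layer t x)) = g x" for x
    using H.pair_finite_verts by simp
  have "fixing_function (G \<odot> H) f"
    using g(1) unfolding fixing_function_corona_iff sum_f
    by (auto simp: f_layer fixing_function_def)
  then have "fix_f (G \<odot> H) \<le> (\<Sum>y\<in>pverts (G \<odot> H). f y)"
    by (rule fix_f_attained(2)[OF C.pair_finite_verts])
  then show ?thesis
    unfolding pverts_corona sum_over_layers sum_f g(2) .
qed

text \<open>
  The weights above the vertices of \<open>G\<close> may exceed \<open>1\<close>, which a fixing function does not allow.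
  Cutting them off does not increase the total, and it preserves the fixing condition.
\<close>

lemma fix_f_le_corona: "fix_f G \<le> fix_f (G \<odot> H)"
proof -
  interpret G: pair_graph G by (rule G_graph)
  interpret C: pair_graph "G \<odot> H" using pair_graph_corona[OF G_graph H] .
  obtain f where f: "fixing_function (G \<odot> H) f" "fix_f (G \<odot> H) = (\<Sum>y\<in>pverts (G \<odot> H). f y)"
    using fix_f_attained(1)[OF C.pair_finite_verts] by blast
  define w where "w x = (\<Sum>t\<in>layers H. f (layer t x))" for x
  have w_nonneg: "0 \<le> w x" if "x \<in> pverts G" for x
    using f(1) that unfolding w_def fixing_function_corona_iff by (intro sum_nonneg) blast
  have w_sum: "1 \<le> (\<Sum>x\<in>fixing_nbhd G u v. w x)" if "(u, v) \<in> similar_pairs G" for u v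
    using f(1) that unfolding w_def fixing_function_corona_iff by blast
  define g where "g x = min 1 (w x)" for x
  have "fixing_function G g"
    unfolding fixing_function_def
  proof (intro conjI ballI)
    fix x assume "x \<in> pverts G"
    then show "0 \<le> g x" "g x \<le> 1" using w_nonneg by (auto simp: g_def)
  next
    fix p assume "p \<in> similar_pairs G"
    then obtain u v where p: "p = (u, v)" and uv: "(u, v) \<in> similar_pairs G" by (cases p) auto
    let ?F = "fixing_nbhd G u v"
    have F: "?F \<subseteq> pverts G" "finite ?F"
      using G.pair_finite_verts by (auto simp: fixing_nbhd_def)
    have "1 \<le> (\<Sum>x\<in>?F. g x)"
    proof (cases "\<exists>x\<in>?F. w x > 1")
      \<comment> \<open>a single weight that is cut off already contributes \<open>1\<close>\<close>
      case True
      then obtain x where x: "x \<in> ?F" "g x = 1" by (auto simp: g_def)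
      have "g x \<le> (\<Sum>x\<in>?F. g x)"
        using F x(1) w_nonneg by (intro member_le_sum) (auto simp: g_def)
      then show ?thesis using x(2) by simp
    next
      case False
      then have "(\<Sum>x\<in>?F. g x) = (\<Sum>x\<in>?F. w x)"
        by (intro sum.cong) (auto simp: g_def)
      then show ?thesis using w_sum[OF uv] by simp
    qed
    then show "case p of (u, v) \<Rightarrow> 1 \<le> (\<Sum>x\<in>fixing_nbhd G u v. g x)"
      by (simp add: p)
  qed
  then have "fix_f G \<le> (\<Sum>x\<in>pverts G. g x)"
    by (rule fix_f_attained(2)[OF G.pair_finite_verts])
  also have "\<dots> \<le> (\<Sum>x\<in>pverts G. w x)"
    by (intro sum_mono) (simp add: g_def)
  also have "\<dots> = fix_f (G \<odot> H)"
    unfolding f(2) pverts_corona sum_over_layers w_def ..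
  finally show ?thesis .
qed

end

theorem theorem5p3:
  fixes G :: "'a pair_pre_digraph" and H :: "'b pair_pre_digraph"
  assumes "nontrivial_graph G" and "Digraph_Component.connected (with_proj G)"
    and "nontrivial_graph H" and "rigid H"
  shows "fix_f (G \<odot> H) = fix_f G"
proof -
  have H: "pair_graph H" using assms(3) by (simp add: nontrivial_graph_def)
  show ?thesis
    using fix_f_corona_le[OF assms(1,2) H assms(4)] fix_f_le_corona[OF assms(1,2) H assms(4)]
    by (rule antisym)
qed

end
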